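(* For every $n\in\mathbb{N}_0$ and every $k$ (a variable, or any complex number), the polynomials ${}_{T}B_{n}^{(s,v)}(x,y,z;\lambda)$ satisfy $${}_{T}B_{n}^{(s,v)}(x+k,y,z;\lambda)=\sum_{r=0}^n\binom{n}{r}\,B_{n-r}^{(s,v)}(x,z;\lambda)\,T_{r}(k,y).$$
   Context: $\mathbb{N}_0=\{0,1,2,\dots\}$; $x,y,z$ are variables (taking complex values) and $\lambda\in\mathbb{C}\setminus\{0\}$. Let $\mathcal{U}(y,t)=\sum_{n\ge0}\mathcal{U}_n(y)\frac{t^n}{n!}$ be a power series in $t$ with coefficients depending on $y$ and $\mathcal{U}_0(y)\neq0$; the 2-variable general polynomials $T_n(x,y)$ are defined by $e^{xt}\mathcal{U}(y,t)=\sum_{n\ge0}T_n(x,y)\frac{t^n}{n!}$, with the normalization $T_0(x,y)=1$. The order $v$ is such that $\bigl(\frac{t}{\lambda e^t-1}\bigr)^v$ is a power series in $t$ ($v\in\mathbb{N}_0$ in general; $v\in\mathbb{C}$ allowed when $\lambda=1$, with the branch $1^v=1$ at $t=0$). The sine parametric kind of generalized Apostol--Bernoulli polynomials is defined, as power series in $t$, by $$\Bigl(\frac{t}{\lambda e^t-1}\Bigr)^v e^{xt}\,\mathcal{U}(y,t)\sin(zt)=\sum_{n=0}^\infty {}_{T}B_{n}^{(s,v)}(x,y,z;\lambda)\frac{t^n}{n!}.$$ The two-variable parametric Apostol--Bernoulli polynomials $B_n^{(s,v)}(x,y;\lambda)$ are defined by $$\Bigl(\frac{t}{\lambda e^t-1}\Bigr)^v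 e^{xt}\sin(yt)=\sum_{n=0}^\infty B_n^{(s,v)}(x,y;\lambda)\frac{t^n}{n!}.$$ *)

theory Defs
  imports Complex_Main "HOL-Computational_Algebra.Formal_Power_Series"
begin

text \<open>
  All generating functions are formal power series in \<open>t\<close> over the complex numbers;
  \<open>fps_X\<close> plays the role of \<open>t\<close>.
\<close>

definition egf :: "(nat \<Rightarrow> complex) \<Rightarrow> complex fps" where
  "egf a = Abs_fps (\<lambda>n. a n / fact n)"

definition egf_coeff :: "complex fps \<Rightarrow> nat \<Rightarrow> complex" where
  "egf_coeff F n = fact n * fps_nth F n"

lemma egf_egf_coeff: "egf (egf_coeff F) = F"
  by (simp add: egf_def egf_coeff_def fps_eq_iff)

lemma egf_eq_iff: "egf a = F \<longleftrightarrow> a = egf_coeff F"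
  by (auto simp: egf_def egf_coeff_def fps_eq_iff fun_eq_iff field_simps)


definition apostol_base :: "complex \<Rightarrow> complex fps" where
  "apostol_base l = fps_X / (fps_const l * fps_exp 1 - 1)"

text \<open>
  Division of power series is total; the next lemma shows that the quotient is exact,
  also for \<open>l = 1\<close>, where the denominator is not a unit.
\<close>

lemma apostol_base_mult: "apostol_base l * (fps_const l * fps_exp 1 - 1) = fps_X"
proof -
  let ?d = "fps_const l * fps_exp 1 - 1 :: complex fps"
  have d1: "fps_nth ?d 1 = l" and d0: "fps_nth ?d 0 = l - 1"
    by (simp_all add: fps_exp_def)
  have nz: "?d \<noteq> 0"
  proof
    assume "?d = 0"
    then have "fps_nth ?d 0 = 0" "fps_nth ?d 1 = 0" by simp_all
    then show False using d0 d1 by simp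
  qed
  have "subdegree ?d \<le> 1"
  proof (cases "l = 0")
    case True
    then have "fps_nth ?d 0 \<noteq> 0" using d0 by simp
    then have "subdegree ?d \<le> 0" by (rule subdegree_leI)
    then show ?thesis by simp
  next
    case False
    then have "fps_nth ?d 1 \<noteq> 0" using d1 by simp
    then show ?thesis by (rule subdegree_leI)
  qed
  then have "?d dvd fps_X" using nz by (simp add: fps_dvd_iff)
  then show ?thesis by (simp add: apostol_base_def)
qed

lemma apostol_base_1_nth_0: "fps_nth (apostol_base 1) 0 = 1"
proof -
  have "fps_nth (apostol_base 1 * (fps_const 1 * fps_exp 1 - 1)) 1 = (1 :: complex)"
    by (simp only: apostol_base_mult) simp
  then show ?thesis by (simp add: fps_mult_nth)
qed

text \<open>
  The series \<open>(t / (l e\<^sup>t - 1))\<^sup>v\<close>.  For a natural number \<open>v\<close> it is the ordinary power.  For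
  \<open>l = 1\<close> the base is \<open>1 + w\<close> with \<open>w\<close> vanishing at \<open>t = 0\<close>, and for an arbitrary complex \<open>v\<close>
  the power is the binomial series in \<open>w\<close>, i.e. the branch with value \<open>1\<close> at \<open>t = 0\<close>.
  Meaningful only if \<open>v\<close> is a natural number or \<open>l = 1\<close>.
\<close>

definition apostol_factor :: "complex \<Rightarrow> complex \<Rightarrow> complex fps" where
  "apostol_factor l v =
     (if v \<in> \<nat> then apostol_base l ^ (THE m. v = of_nat m)
      else fps_binomial v oo (apostol_base l - 1))"

lemma apostol_factor_of_nat: "apostol_factor l (of_nat m) = apostol_base l ^ m"
  by (simp add: apostol_factor_def)

lemma apostol_factor_1: "apostol_factor 1 v = fps_binomial v oo (apostol_base 1 - 1)"
proof (cases "v \<in> \<nat>")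
  case True
  then obtain m where m: "v = of_nat m" by (auto elim: Nats_cases)
  have c0: "fps_nth (apostol_base 1 - 1) 0 = 0"
    by (simp add: apostol_base_1_nth_0)
  have "fps_binomial v oo (apostol_base 1 - 1) = ((1 + fps_X) oo (apostol_base 1 - 1)) ^ m"
    by (simp only: m fps_binomial_of_nat fps_compose_power[OF c0])
  also have "(1 + fps_X) oo (apostol_base 1 - 1) = apostol_base 1"
    using c0 by (simp add: fps_compose_add_distrib)
  finally show ?thesis by (simp add: m apostol_factor_of_nat)
qed (simp add: apostol_factor_def)


text \<open>
  In the following \<open>U n y\<close> is the coefficient \<open>U\<^sub>n(y)\<close> of \<open>t\<^sup>n / n!\<close> in \<open>U(y,t)\<close>.
\<close>

definition gen_poly :: "(nat \<Rightarrow> complex \<Rightarrow> complex) \<Rightarrow> nat \<Rightarrow> complex \<Rightarrow> complex \<Rightarrow> complex" where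
  "gen_poly U n x y = egf_coeff (fps_exp x * egf (\<lambda>m. U m y)) n"

definition sine_gen_apostol_bernoulli ::
  "(nat \<Rightarrow> complex \<Rightarrow> complex) \<Rightarrow> complex \<Rightarrow> complex \<Rightarrow> nat \<Rightarrow> complex \<Rightarrow> complex \<Rightarrow> complex \<Rightarrow> complex"
where
  "sine_gen_apostol_bernoulli U l v n x y z =
     egf_coeff (apostol_factor l v * fps_exp x * egf (\<lambda>m. U m y) * fps_sin z) n"

definition sine_apostol_bernoulli ::
  "complex \<Rightarrow> complex \<Rightarrow> nat \<Rightarrow> complex \<Rightarrow> complex \<Rightarrow> complex"
where
  "sine_apostol_bernoulli l v n x y =
     egf_coeff (apostol_factor l v * fps_exp x * fps_sin y) n"

end

theory Submission
  imports Defs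
begin

text \<open>Since \<open>fps_exp (x + k)\<close> is \<open>fps_exp x * fps_exp k\<close>, the
  generating function splits into that of \<open>sine_apostol_bernoulli\<close> at \<open>x\<close>,
  \<open>z\<close> times that of \<open>gen_poly\<close> at \<open>k\<close>, \<open>y\<close>.
  Binomial convolution of coefficients gives the sum.\<close>

lemma egf_coeff_mult:
  "egf_coeff (F * G) n = (\<Sum>r=0..n. of_nat (n choose r) * egf_coeff F (n - r) * egf_coeff G r)"
proof -
  \<comment> \<open>\<open>fps_mult_nth\<close> indexes by the first factor, so \<open>G\<close>
    goes first to carry \<open>r\<close>.\<close>
  have "egf_coeff (G * F) n =
      (\<Sum>r=0..n. of_nat (n choose r) * egf_coeff F (n - r) * egf_coeff G r)"
    unfolding egf_coeff_def fps_mult_nth sum_distrib_left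
    by (intro sum.cong) (simp_all add: binomial_fact)
  then show ?thesis by (simp only: mult.commute)
qed

theorem theorem3p4:
  fixes U :: "nat \<Rightarrow> complex \<Rightarrow> complex"
    and l v x y z k :: complex
    and n :: nat
  assumes "l \<noteq> 0"
    and "v \<in> \<nat> \<or> l = 1"
    and "\<And>y. U 0 y \<noteq> 0"
    and "\<And>x y. gen_poly U 0 x y = 1"
  shows "sine_gen_apostol_bernoulli U l v n (x + k) y z =
    (\<Sum>r=0..n. of_nat (n choose r) * sine_apostol_bernoulli l v (n - r) x z * gen_poly U r k y)"
proof -
  have "apostol_factor l v * fps_exp (x + k) * egf (\<lambda>m. U m y) * fps_sin z =
      (apostol_factor l v * fps_exp x * fps_sin z) * (fps_exp k * egf (\<lambda>m. U m y))"
    by (simp add: fps_exp_add_mult mult_ac)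
  then show ?thesis
    \<comment> \<open>The argument of \<open>egf_coeff\<close> is regrouped before it is expanded;
      the inner products then expand alike on both sides.\<close>
    by (simp only: sine_gen_apostol_bernoulli_def sine_apostol_bernoulli_def gen_poly_def
        egf_coeff_mult)
qed

end
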